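(* Let $P$ be the uniform distribution on the unit circle $x_1^2+x_2^2=1$ in $\mathbb{R}^2$, and let $n\in\mathbb{N}$. Then the set $$\alpha_n=\Big\{\frac{n}{\pi}\Big(\sin\frac{\pi}{n}\cdot\cos\big((2j-1)\tfrac{\pi}{n}\big),\ \sin\frac{\pi}{n}\cdot\sin\big((2j-1)\tfrac{\pi}{n}\big)\Big) : j=1,2,\dots,n\Big\}$$ is an optimal set of $n$-means for $P$, and the corresponding $n$th quantization error is $$V_n(P)=1-\frac{n^2}{\pi^2}\sin^2\Big(\frac{\pi}{n}\Big).$$
   Context: The uniform distribution $P$ on the unit circle is the Borel probability measure on $\mathbb{R}^2$ supported on the circle given by normalized arc length, i.e. the image of $\frac{1}{2\pi}d\theta$ on $[0,2\pi]$ under $\theta\mapsto(\cos\theta,\sin\theta)$. For a Borel probability measure $P$ on $\mathbb{R}^d$ (here $d=2$) with $\int\|x\|^2dP(x)<\infty$ and a nonempty finite set $\alpha\subset\mathbb{R}^d$, put $V(P;\alpha)=\int\min_{c\in\alpha}\|x-c\|^2\,dP(x)$, with $\|\cdot\|$ the Euclidean norm. The $n$th quantization error is $V_n(P)=\inf\{V(P;\alpha):\alpha\subset\mathbb{R}^d,\ 1\le\operatorname{card}(\alpha)\leq n\}$. An optimal set of $n$-means for $P$ is a set $\alpha$ with at most $n$ points for which this infimum is attained. $\mathbb{N}=\{1,2,3,\dots\}$. *)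

theory Defs
  imports "HOL-Probability.Probability"
begin

definition distortion :: "'a::euclidean_space measure \<Rightarrow> 'a set \<Rightarrow> real" where
  "distortion P \<alpha> = (\<integral>x. Min ((\<lambda>c. (norm (x - c))\<^sup>2) ` \<alpha>) \<partial>P)"

definition codebooks :: "nat \<Rightarrow> 'a::euclidean_space set set" where
  "codebooks n = {\<alpha>. finite \<alpha> \<and> 1 \<le> card \<alpha> \<and> card \<alpha> \<le> n}"

definition quantization_error :: "nat \<Rightarrow> 'a::euclidean_space measure \<Rightarrow> real" where
  "quantization_error n P = (INF \<alpha>\<in>codebooks n. distortion P \<alpha>)"

definition optimal_n_means :: "nat \<Rightarrow> 'a::euclidean_space measure \<Rightarrow> 'a set \<Rightarrow> bool" where
  "optimal_n_means n P \<alpha> \<longleftrightarrow> \<alpha> \<in> codebooks n \<and> distortion P \<alpha> = quantization_error n P"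

definition circle_point :: "real \<Rightarrow> real^2" where
  "circle_point \<theta> = vector [cos \<theta>, sin \<theta>]"

definition uniform_circle :: "(real^2) measure" where
  "uniform_circle = distr (uniform_measure lborel {0..2 * pi}) borel circle_point"

definition circle_means :: "nat \<Rightarrow> (real^2) set" where
  "circle_means n =
    (\<lambda>j. (real n / pi) *\<^sub>R
       (vector [sin (pi / real n) * cos ((2 * real j - 1) * (pi / real n)),
                sin (pi / real n) * sin ((2 * real j - 1) * (pi / real n))] :: real^2)) ` {1..n}"

text \<open>The integral in \<^const>\<open>distortion\<close> and the infimum in \<^const>\<open>quantization_error\<close> are total
  functions with junk values outside their intended domain. The facts below rule this out for
  \<^const>\<open>uniform_circle\<close>.\<close>

lemma circle_point_measurable [measurable]: "circle_point \<in> borel_measurable borel"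
proof -
  have "circle_point = (\<lambda>\<theta>. \<chi> i. if i = 1 then cos \<theta> else sin \<theta>)"
    by (simp add: fun_eq_iff circle_point_def vec_eq_iff forall_2)
  moreover have "continuous_on UNIV (\<lambda>\<theta>::real. (\<chi> i. if i = 1 then cos \<theta> else sin \<theta>) :: real^2)"
  proof (rule continuous_on_vec_lambda)
    show "continuous_on UNIV (\<lambda>\<theta>::real. if i = 1 then cos \<theta> else sin \<theta>)" for i :: 2
      by (cases "i = 1") (auto intro!: continuous_intros)
  qed
  ultimately show ?thesis by (metis borel_measurable_continuous_onI)
qed

lemma norm_circle_point: "norm (circle_point \<theta>) = 1"
  by (simp add: circle_point_def norm_vec_def L2_set_def sum_2)

lemma prob_space_uniform_circle: "prob_space uniform_circle"
proof -
  have "prob_space (uniform_measure lborel {0..2 * pi})"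
    by (rule prob_space_uniform_measure) auto
  then show ?thesis
    unfolding uniform_circle_def by (rule prob_space.prob_space_distr) simp
qed

lemma AE_uniform_circle: "AE x in uniform_circle. norm x = 1"
  unfolding uniform_circle_def by (subst AE_distr_iff) (auto simp: norm_circle_point)

lemma integrable_distortion_uniform_circle:
  assumes "finite \<alpha>" "\<alpha> \<noteq> {}"
  shows "integrable uniform_circle (\<lambda>x. Min ((\<lambda>c. (norm (x - c))\<^sup>2) ` \<alpha>))"
proof -
  interpret prob_space uniform_circle by (rule prob_space_uniform_circle)
  obtain c where c: "c \<in> \<alpha>" using assms by auto
  have "AE x in uniform_circle. norm (Min ((\<lambda>c. (norm (x - c))\<^sup>2) ` \<alpha>)) \<le> (1 + norm c)\<^sup>2"
    using AE_uniform_circle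
  proof eventually_elim
    case (elim x)
    have "0 \<le> Min ((\<lambda>c. (norm (x - c))\<^sup>2) ` \<alpha>)" using assms by simp
    moreover have "Min ((\<lambda>c. (norm (x - c))\<^sup>2) ` \<alpha>) \<le> (norm (x - c))\<^sup>2"
      using assms c by simp
    moreover have "(norm (x - c))\<^sup>2 \<le> (1 + norm c)\<^sup>2"
      using norm_triangle_ineq4[of x c] elim by (intro power_mono) auto
    ultimately show ?case unfolding real_norm_def by linarith
  qed
  moreover have "(\<lambda>x. Min ((\<lambda>c. (norm (x - c))\<^sup>2) ` \<alpha>)) \<in> borel_measurable uniform_circle"
  proof -
    have "(\<lambda>x::real^2. Min ((\<lambda>c. (norm (x - c))\<^sup>2) ` \<alpha>)) \<in> borel_measurable borel"
      using assms
    proof (induction rule: finite_ne_induct)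
      case (insert a F)
      have "(\<lambda>x. Min ((\<lambda>c. (norm (x - c))\<^sup>2) ` insert a F)) =
          (\<lambda>x. min ((norm (x - a))\<^sup>2) (Min ((\<lambda>c. (norm (x - c))\<^sup>2) ` F)))"
        using insert by auto
      then show ?case using insert by simp
    qed simp
    then show ?thesis by (simp add: uniform_circle_def)
  qed
  ultimately show ?thesis by (rule integrable_const_bound)
qed

lemma codebooks_nonempty: "1 \<le> n \<Longrightarrow> codebooks n \<noteq> {}"
  by (auto simp: codebooks_def intro!: exI[of _ "{0}"])

lemma distortion_nonneg: "\<alpha> \<in> codebooks n \<Longrightarrow> 0 \<le> distortion P \<alpha>"
  unfolding distortion_def codebooks_def
  by (rule Bochner_Integration.integral_nonneg) (auto simp: Min_ge_iff card_gt_0_iff Suc_le_eq)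

lemma bdd_below_distortion: "bdd_below (distortion P ` codebooks n)"
  by (rule bdd_belowI2[of _ 0]) (rule distortion_nonneg)

end

theory Submission
  imports Defs
begin

text \<open>
  For a point \<open>x\<close> of the circle and a centre \<open>c\<close>, the squared distance is
  \<open>1 - f\<^sub>c(x)\<close> with \<open>f\<^sub>c(x) = 2 x \<bullet> c - \<bar>c\<bar>\<^sup>2\<close>, so minimising the
  distortion means maximising the mean of \<open>max\<^sub>c f\<^sub>c\<close>. The \<open>n\<close> given points
  are the centroids of \<open>n\<close> equal arcs; assigning every arc to its own centroid bounds their
  distortion by the claimed value (lemma \<open>distortion_circle_means_le\<close>).

  The lower bound is a Lagrangian argument that avoids Voronoi cells altogether. For every real
  number \<open>l\<close> the pointwise inequality \<open>max\<^sub>c f\<^sub>c \<le> l + (\<Sum>c. max 0 (f\<^sub>c - l))\<close>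
  decouples the centres. The function \<open>f\<^sub>c - l\<close> is positive on an arc, possibly empty or
  the whole circle, centred at the direction of \<open>c\<close>. If this arc has half-angle \<open>t\<close> and \<open>\<bar>c\<bar> = r\<close>, then
  the excess integrates to \<open>2 (2 r sin t - (r\<^sup>2 + l) t)\<close>, which is at most
  \<open>2 (g t - l t)\<close> for \<open>g t = (sin t)\<^sup>2 / t\<close> (optimise in \<open>r\<close>). Taking \<open>l\<close> to be
  the slope of \<open>g\<close> at \<open>a = \<pi> / n\<close>, all that remains is that the graph of \<open>g\<close> on
  \<open>(0, \<pi>]\<close> lies below its tangent at \<open>a\<close> (lemma
  \<open>arc_gain_le_tangent_at_half_sector\<close>): then each centre contributes at most twice the
  intercept of this tangent, and \<open>n\<close> centres together give exactly the distortion of the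
  regular configuration.

  The tangent inequality holds on \<open>(0, \<pi> / 2]\<close> because \<open>g\<close> is concave there. Beyond
  \<open>\<pi> / 2\<close> concavity is lost, and the reflection \<open>t \<mapsto> \<pi> - t\<close> takes its place. For
  \<open>n = 1\<close> the point of contact is \<open>\<pi>\<close> and the tangent inequality is false; but a single
  centre at distance \<open>r\<close> from the origin has distortion \<open>1 + r\<^sup>2\<close>.
\<close>

section \<open>The gain of an arc\<close>

text \<open>
  Half of the largest value of \<open>\<integral> 2 r cos \<phi> - r\<^sup>2 d\<phi>\<close> over \<open>[-t, t]\<close>, as \<open>r\<close>
  varies, that is, half of what an arc of half-angle \<open>t\<close> gains when its centre moves from the origin to the
  centroid of the arc, at distance \<open>sin t / t\<close>.
\<close>
definition arc_gain :: "real \<Rightarrow> real" where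
  "arc_gain t = (sin t)\<^sup>2 / t"

text \<open>The derivative of \<^const>\<open>arc_gain\<close>.\<close>
definition arc_gain_slope :: "real \<Rightarrow> real" where
  "arc_gain_slope t = sin (2 * t) / t - (sin t)\<^sup>2 / t\<^sup>2"

text \<open>The value at \<open>0\<close> of the tangent to \<^const>\<open>arc_gain\<close> at \<open>a\<close>.\<close>
definition arc_gain_intercept :: "real \<Rightarrow> real" where
  "arc_gain_intercept a = arc_gain a - arc_gain_slope a * a"

text \<open>
  The left-hand side is \<open>t\<^sup>3 / 2\<close> times the second derivative of \<^const>\<open>arc_gain\<close>. It
  vanishes at \<open>0\<close>, and in its derivative everything cancels except
  \<open>- 2 t\<^sup>2 sin (2 t)\<close>, which has a sign up to \<open>\<pi> / 2\<close>.
\<close>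
lemma arc_gain_second_derivative_numerator_nonpos:
  fixes t :: real
  assumes "0 \<le> t" "t \<le> pi / 2"
  shows "t\<^sup>2 * cos (2 * t) - t * sin (2 * t) + (sin t)\<^sup>2 \<le> 0"
proof -
  let ?q = "\<lambda>t::real. t\<^sup>2 * cos (2 * t) - t * sin (2 * t) + (sin t)\<^sup>2"
  have "?q t \<le> ?q 0"
  proof (rule DERIV_nonpos_imp_nonincreasing[OF assms(1)])
    fix x :: real assume x: "0 \<le> x" "x \<le> t"
    have "(?q has_real_derivative - (2 * x\<^sup>2 * sin (2 * x))) (at x)"
      by (auto intro!: derivative_eq_intros simp: sin_double[of x, unfolded mult.commute[of 2 x]]
          algebra_simps power2_eq_square)
    moreover have "sin (2 * x) \<ge> 0" using x assms by (intro sin_ge_zero) auto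
    ultimately show "\<exists>y. (?q has_real_derivative y) (at x) \<and> y \<le> 0"
      by (intro exI[of _ "- (2 * x\<^sup>2 * sin (2 * x))"]) simp
  qed
  then show ?thesis by simp
qed

lemma arc_gain_le_tangent:
  assumes a: "0 < a" "a \<le> pi / 2" and t: "0 < t" "t \<le> pi / 2"
  shows "arc_gain t \<le> arc_gain_intercept a + arc_gain_slope a * t"
proof -
  \<comment> \<open>the second derivative of \<^const>\<open>arc_gain\<close>\<close>
  define g2 where "g2 x = 2 * (x\<^sup>2 * cos (2 * x) - x * sin (2 * x) + (sin x)\<^sup>2) / x ^ 3" for x :: real
  have "- arc_gain_slope a * (t - a) \<le> - arc_gain t - - arc_gain a"
  proof (rule f''_imp_f'[where C = "{0<..pi / 2}" and f'' = "\<lambda>x. - g2 x"])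
    fix x :: real assume "x \<in> {0<..pi / 2}"
    then have x: "0 < x" "x \<le> pi / 2" by auto
    have dbl: "sin (x * 2) = 2 * sin x * cos x" using sin_double[of x] by (simp add: mult.commute)
    show "((\<lambda>x. - arc_gain x) has_real_derivative - arc_gain_slope x) (at x)"
      unfolding arc_gain_def arc_gain_slope_def using x
      by (auto intro!: derivative_eq_intros simp: dbl field_simps power2_eq_square)
    show "((\<lambda>x. - arc_gain_slope x) has_real_derivative - g2 x) (at x)"
      unfolding arc_gain_slope_def g2_def using x
      by (auto intro!: derivative_eq_intros simp: dbl field_simps power2_eq_square power3_eq_cube)
    show "0 \<le> - g2 x"
      unfolding g2_def using arc_gain_second_derivative_numerator_nonpos[of x] x
      by (simp add: divide_nonpos_pos)
  qed (use a t in auto)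
  then show ?thesis by (simp add: arc_gain_intercept_def algebra_simps)
qed

text \<open>
  The intercept equals \<open>2 sin a (sin a - a cos a) / a\<close>. Its sign makes superfluous centres
  harmless: using fewer than \<open>n\<close> of them, or one whose arc is empty, cannot beat the bound.
\<close>
lemma arc_gain_intercept_nonneg:
  assumes "0 < a" "a \<le> pi / 2"
  shows "0 \<le> arc_gain_intercept a"
proof -
  let ?d = "\<lambda>t::real. sin t - t * cos t"
  have "?d 0 \<le> ?d a"
  proof (rule DERIV_nonneg_imp_nondecreasing[where f = ?d])
    fix x :: real assume x: "0 \<le> x" "x \<le> a"
    have "(?d has_real_derivative x * sin x) (at x)"
      by (auto intro!: derivative_eq_intros)
    moreover have "sin x \<ge> 0" using x assms by (intro sin_ge_zero) auto
    ultimately show "\<exists>y. (?d has_real_derivative y) (at x) \<and> 0 \<le> y"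
      using x by (intro exI[of _ "x * sin x"]) simp
  qed (use assms in simp)
  moreover have "sin a \<ge> 0" using assms by (intro sin_ge_zero) auto
  ultimately have "0 \<le> 2 * sin a * (sin a - a * cos a) / a" using assms by simp
  also have "\<dots> = arc_gain_intercept a"
    unfolding arc_gain_intercept_def arc_gain_def arc_gain_slope_def sin_double
    using assms by (simp add: field_simps power2_eq_square)
  finally show ?thesis .
qed

lemma half_sector_bounds:
  assumes "2 \<le> n"
  shows "0 < pi / real n" "pi / real n \<le> pi / 2"
proof -
  show "0 < pi / real n" using assms by simp
  show "pi / real n \<le> pi / 2" using assms by (intro divide_left_mono) simp_all
qed

text \<open>
  \<^const>\<open>arc_gain\<close> vanishes at \<open>\<pi>\<close>, so this is the tangent inequality at that end point.
  It is an equality for \<open>n = 2\<close>. For \<open>n \<ge> 3\<close> it reduces to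
  \<open>(n - 2) sin a \<le> 2 (n - 1) a cos a\<close>, which follows from \<open>sin a \<le> a\<close> and
  \<open>cos a \<ge> 1 / 2\<close>.
\<close>
lemma tangent_at_pi_nonneg:
  assumes n: "2 \<le> n" and a: "a = pi / real n"
  shows "0 \<le> arc_gain_intercept a + arc_gain_slope a * pi"
proof -
  have a0: "0 < a" and an: "a \<le> pi / 2" using half_sector_bounds[OF n] a by auto
  have s: "0 \<le> sin a" "sin a \<le> a" using a0 an by (auto intro!: sin_ge_zero sin_x_le_x)
  have "(real n - 2) * sin a \<le> 2 * (real n - 1) * cos a * a"
  proof (cases "n = 2")
    case False
    then have n3: "3 \<le> n" using n by simp
    then have "a \<le> pi / 3" unfolding a by (intro divide_left_mono) simp_all
    then have "cos (pi / 3) \<le> cos a" using a0 by (intro cos_monotone_0_pi_le) auto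
    then have "(real n - 1) * 1 \<le> (real n - 1) * (2 * cos a)"
      using n3 by (intro mult_left_mono) (simp_all add: cos_60)
    then have "real n - 2 \<le> (real n - 1) * (2 * cos a)" by simp
    then have "(real n - 2) * sin a \<le> ((real n - 1) * (2 * cos a)) * a"
      using s n3 a0 by (intro mult_mono) linarith+
    then show ?thesis by (simp add: mult_ac)
  qed (use a a0 an cos_ge_zero[of a] in simp)
  then have "(real n - 2) * sin a * sin a \<le> 2 * (real n - 1) * cos a * a * sin a"
    using s by (intro mult_right_mono) auto
  moreover have "arc_gain_intercept a + arc_gain_slope a * (real n * a) =
      (2 * (real n - 1) * cos a * a * sin a - (real n - 2) * sin a * sin a) / a"
    unfolding arc_gain_intercept_def arc_gain_def arc_gain_slope_def sin_double
    using a0 by (simp add: field_simps power2_eq_square)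
  moreover have "real n * a = pi" using assms by simp
  ultimately show ?thesis using a0 by simp
qed

text \<open>
  For \<open>t > \<pi> / 2\<close> both sides are compared with \<open>4 (\<pi> - t) / \<pi>\<^sup>2\<close>. The tangent lies
  above this line on \<open>[\<pi> / 2, \<pi>]\<close> because it does so at the two end points. Since
  \<open>sin t = sin (\<pi> - t)\<close>, that \<^const>\<open>arc_gain\<close> lies below it is the tangent inequality with
  contact point \<open>\<pi> / 2\<close>, evaluated at \<open>\<pi> - t\<close>.
\<close>
lemma arc_gain_le_tangent_at_half_sector:
  assumes n: "2 \<le> n" and a: "a = pi / real n" and t: "0 < t" "t \<le> pi"
  shows "arc_gain t \<le> arc_gain_intercept a + arc_gain_slope a * t"
proof (cases "t \<le> pi / 2")
  case True
  then show ?thesis using arc_gain_le_tangent[of a t] half_sector_bounds[OF n] a t by simp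
next
  case False
  have a0: "0 < a" "a \<le> pi / 2" using half_sector_bounds[OF n] a by auto
  define K l where "K = arc_gain_intercept a" and "l = arc_gain_slope a"
  have mid: "2 / pi \<le> K + l * (pi / 2)"
    using arc_gain_le_tangent[of a "pi / 2"] a0 by (simp add: K_def l_def arc_gain_def)
  have fin: "0 \<le> K + l * pi"
    using tangent_at_pi_nonneg[OF n a] by (simp add: K_def l_def)
  have line: "4 / pi\<^sup>2 * (pi - t) \<le> K + l * t"
  proof -
    \<comment> \<open>\<open>t\<close> is the convex combination of \<open>\<pi> / 2\<close> and \<open>\<pi>\<close> with these weights\<close>
    have "(2 - 2 * t / pi) * (2 / pi) + (2 * t / pi - 1) * 0 \<le>
        (2 - 2 * t / pi) * (K + l * (pi / 2)) + (2 * t / pi - 1) * (K + l * pi)"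
      using mid fin t False by (intro add_mono mult_left_mono) (auto simp: field_simps)
    also have "\<dots> = K + l * t" by (simp add: field_simps)
    finally show ?thesis by (simp add: field_simps power2_eq_square)
  qed
  have "(sin t)\<^sup>2 \<le> 4 / pi\<^sup>2 * (pi - t) * t"
  proof (cases "t = pi")
    case False
    define s where "s = pi - t"
    have s: "0 < s" "s \<le> pi / 2" using False \<open>\<not> t \<le> pi / 2\<close> t by (auto simp: s_def)
    have "arc_gain s \<le> arc_gain_intercept (pi / 2) + arc_gain_slope (pi / 2) * s"
      using s by (intro arc_gain_le_tangent) auto
    also have "\<dots> = 4 / pi\<^sup>2 * (pi - s)"
      by (simp add: arc_gain_intercept_def arc_gain_def arc_gain_slope_def field_simps power2_eq_square)
    finally have "(sin s)\<^sup>2 \<le> 4 / pi\<^sup>2 * (pi - s) * s"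
      using s by (simp add: arc_gain_def pos_divide_le_eq)
    then show ?thesis by (simp add: s_def mult_ac)
  qed simp
  then have "arc_gain t \<le> 4 / pi\<^sup>2 * (pi - t)" using t by (simp add: arc_gain_def pos_divide_le_eq)
  then show ?thesis using line by (simp add: K_def l_def)
qed

text \<open>
  The left-hand side is quadratic in \<open>r\<close> with maximum \<open>arc_gain t - arc_gain_slope a * t\<close>,
  attained at \<open>r = sin t / t\<close>.
\<close>
lemma cell_gain_le_intercept:
  assumes n: "2 \<le> n" and a: "a = pi / real n" and t: "0 \<le> t" "t \<le> pi"
  shows "2 * r * sin t - (r\<^sup>2 + arc_gain_slope a) * t \<le> arc_gain_intercept a"
proof (cases "t = 0")
  case True
  then show ?thesis using arc_gain_intercept_nonneg[of a] half_sector_bounds[OF n] a by simp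
next
  case False
  then have t0: "0 < t" using t by simp
  have "0 \<le> (r * t - sin t)\<^sup>2 / t" using t0 by simp
  also have "\<dots> = arc_gain t - (2 * r * sin t - r\<^sup>2 * t)"
    using t0 by (simp add: arc_gain_def field_simps power2_eq_square)
  finally show ?thesis using arc_gain_le_tangent_at_half_sector[OF n a t0 t(2)]
    by (simp add: algebra_simps)
qed

text \<open>
  The line touches the graph at \<open>a\<close>; dividing by \<open>a\<close> turns this into the identity which
  makes the Lagrangian bound meet the distortion of the regular configuration.
\<close>
lemma tangent_at_contact_point:
  assumes "a \<noteq> 0"
  shows "arc_gain_slope a + arc_gain_intercept a / a = (sin a)\<^sup>2 / a\<^sup>2"
  using assms by (simp add: arc_gain_intercept_def arc_gain_def field_simps power2_eq_square)

section \<open>Integrals over the circle\<close>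

lemma integral_periodic_shift:
  fixes F :: "real \<Rightarrow> real"
  assumes F: "continuous_on UNIV F" and per: "\<And>x. F (x + p) = F x" and psi: "0 \<le> \<psi>" "\<psi> \<le> p"
  shows "integral {0..p} (\<lambda>\<theta>. F (\<theta> - \<psi>)) = integral {0..p} F"
proof -
  have int: "F integrable_on {u..v}" for u v
    by (rule integrable_continuous_real) (rule continuous_on_subset[OF F], simp)
  have "integral {0..p} (\<lambda>\<theta>. F (\<theta> - \<psi>)) = integral {-\<psi>..p - \<psi>} F"
    using integral_shift_real_ivl[of "-\<psi>" "-\<psi>" "p - \<psi>" F] by simp
  also have "\<dots> = integral {-\<psi>..0} F + integral {0..p - \<psi>} F"
    using psi by (intro Henstock_Kurzweil_Integration.integral_combine[symmetric] int) auto
  also have "integral {-\<psi>..0} F = integral {p - \<psi>..p} F"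
    using integral_shift_real_ivl[of "p - \<psi>" p p F] by (simp add: per)
  also have "integral {p - \<psi>..p} F + integral {0..p - \<psi>} F = integral {0..p} F"
    using psi Henstock_Kurzweil_Integration.integral_combine[of 0 "p - \<psi>" p F] int by simp
  finally show ?thesis .
qed

text \<open>Periodicity removes the phase, and \<open>cos (2 \<pi> - \<phi>) = cos \<phi>\<close> folds the circle.\<close>
lemma integral_cos_circle:
  fixes f :: "real \<Rightarrow> real"
  assumes f: "continuous_on UNIV f" and psi: "0 \<le> \<psi>" "\<psi> \<le> 2 * pi"
  shows "integral {0..2 * pi} (\<lambda>\<theta>. f (cos (\<theta> - \<psi>))) = 2 * integral {0..pi} (\<lambda>\<phi>. f (cos \<phi>))"
proof -
  let ?F = "\<lambda>x. f (cos x)"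
  have F: "continuous_on UNIV ?F"
    by (rule continuous_on_compose2[OF f]) (auto intro!: continuous_intros)
  have int: "?F integrable_on {u..v}" for u v
    by (rule integrable_continuous_real) (rule continuous_on_subset[OF F], simp)
  have "integral {0..2 * pi} (\<lambda>\<theta>. ?F (\<theta> - \<psi>)) = integral {0..2 * pi} ?F"
    by (rule integral_periodic_shift[OF F]) (use psi in auto)
  also have "\<dots> = integral {0..pi} ?F + integral {pi..2 * pi} ?F"
    by (rule Henstock_Kurzweil_Integration.integral_combine[symmetric]) (use int in auto)
  also have "integral {pi..2 * pi} ?F = integral {-pi..0} ?F"
    using integral_shift_real_ivl[of pi "2 * pi" "2 * pi" ?F] by (simp add: cos_periodic)
  also have "\<dots> = integral {0..pi} ?F"
    using Henstock_Kurzweil_Integration.integral_reflect_real[of "pi" "0" "?F"] by simp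
  finally show ?thesis by simp
qed

text \<open>
  The cosine decreases on \<open>[0, \<pi>]\<close>, so the integrand is the unclipped function up to some
  angle \<open>t\<close> and zero afterwards. No formula for \<open>t\<close> is given: the bounds on the integral
  below hold for all \<open>t\<close> in \<open>[0, \<pi>]\<close>.
\<close>
lemma integral_positive_part_cos:
  fixes A B :: real
  assumes A: "0 \<le> A"
  obtains t where "0 \<le> t" "t \<le> pi"
    "integral {0..pi} (\<lambda>\<phi>. max 0 (A * cos \<phi> - B)) = A * sin t - B * t"
proof -
  let ?f = "\<lambda>\<phi>. A * cos \<phi> - B"
  have mono: "?f y \<le> ?f x" if "0 \<le> x" "x \<le> y" "y \<le> pi" for x y
    using that A by (simp add: mult_left_mono cos_monotone_0_pi_le)
  have "\<exists>t\<in>{0..pi}. (\<forall>x\<in>{0<..<t}. 0 \<le> ?f x) \<and> (\<forall>x\<in>{t<..<pi}. ?f x \<le> 0)"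
  proof -
    consider "?f 0 \<le> 0" | "0 \<le> ?f pi" | "?f pi \<le> 0" "0 \<le> ?f 0" by linarith
    then show ?thesis
    proof cases
      case 1
      have "?f x \<le> 0" if "x \<in> {0<..<pi}" for x using mono[of 0 x] 1 that by simp
      then show ?thesis by (intro bexI[of _ 0]) simp_all
    next
      case 2
      have "0 \<le> ?f x" if "x \<in> {0<..<pi}" for x using mono[of x pi] 2 that by simp
      then show ?thesis by (intro bexI[of _ pi]) simp_all
    next
      case 3
      have "\<exists>t. 0 \<le> t \<and> t \<le> pi \<and> ?f t = 0"
        by (rule IVT2') (use 3 in \<open>auto intro!: continuous_intros\<close>)
      then obtain t where t: "0 \<le> t" "t \<le> pi" "?f t = 0" by blast
      have "0 \<le> ?f x" if "x \<in> {0<..<t}" for x using mono[of x t] t that by simp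
      moreover have "?f x \<le> 0" if "x \<in> {t<..<pi}" for x using mono[of t x] t that by simp
      ultimately show ?thesis using t by (intro bexI[of _ t]) simp_all
    qed
  qed
  then obtain t where t: "0 \<le> t" "t \<le> pi" and pos: "\<And>x. x \<in> {0<..<t} \<Longrightarrow> 0 \<le> ?f x"
    and neg: "\<And>x. x \<in> {t<..<pi} \<Longrightarrow> ?f x \<le> 0" by auto
  have "(?f has_integral (A * sin t - B * t) - (A * sin 0 - B * 0)) {0..t}"
    using t by (intro fundamental_theorem_of_calculus)
      (auto intro!: derivative_eq_intros simp flip: has_real_derivative_iff_has_vector_derivative)
  then have "((\<lambda>\<phi>. max 0 (?f \<phi>)) has_integral (A * sin t - B * t)) {0..t}"
    using pos has_integral_spike_interior[of ?f "A * sin t - B * t" 0 t "\<lambda>\<phi>. max 0 (?f \<phi>)"] by simp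
  moreover have "((\<lambda>\<phi>. max 0 (?f \<phi>)) has_integral 0) {t..pi}"
    using neg has_integral_spike_interior[of "\<lambda>_. 0" 0 t pi "\<lambda>\<phi>. max 0 (?f \<phi>)"] by simp
  ultimately have "((\<lambda>\<phi>. max 0 (?f \<phi>)) has_integral (A * sin t - B * t) + 0) {0..pi}"
    using t by (intro has_integral_combine[of 0 t pi])
  then show ?thesis using t that by (simp add: integral_unique)
qed

section \<open>Distances on the circle\<close>

lemma power2_norm_real_2:
  fixes c :: "real^2"
  shows "(norm c)\<^sup>2 = (c $ 1)\<^sup>2 + (c $ 2)\<^sup>2"
  unfolding power2_norm_eq_inner by (simp add: inner_vec_def sum_2 power2_eq_square)

lemma norm_circle_point_diff:
  "(norm (circle_point \<theta> - r *\<^sub>R circle_point \<psi>))\<^sup>2 = 1 - 2 * r * cos (\<theta> - \<psi>) + r\<^sup>2"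
proof -
  have "(norm (circle_point \<theta> - r *\<^sub>R circle_point \<psi>))\<^sup>2 =
      (cos \<theta> - r * cos \<psi>)\<^sup>2 + (sin \<theta> - r * sin \<psi>)\<^sup>2"
    by (simp add: circle_point_def power2_norm_real_2)
  also have "\<dots> = ((cos \<theta>)\<^sup>2 + (sin \<theta>)\<^sup>2) - 2 * r * (cos \<theta> * cos \<psi> + sin \<theta> * sin \<psi>)
      + r\<^sup>2 * ((cos \<psi>)\<^sup>2 + (sin \<psi>)\<^sup>2)"
    by algebra
  finally show ?thesis by (simp only: cos_diff sin_cos_squared_add2 mult_1_right)
qed

lemma polar_coordinates:
  fixes c :: "real^2"
  obtains r \<psi> where "0 \<le> r" "0 \<le> \<psi>" "\<psi> \<le> 2 * pi" "c = r *\<^sub>R circle_point \<psi>"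
proof (cases "c = 0")
  case True
  then show ?thesis using that[of 0 0] by simp
next
  case False
  have "(c $ 1 / norm c)\<^sup>2 + (c $ 2 / norm c)\<^sup>2 = 1"
    using False by (simp add: power_divide flip: add_divide_distrib power2_norm_real_2)
  then obtain \<psi> where psi: "0 \<le> \<psi>" "\<psi> < 2 * pi" "c $ 1 / norm c = cos \<psi>" "c $ 2 / norm c = sin \<psi>"
    by (rule sincos_total_2pi)
  have "c = norm c *\<^sub>R circle_point \<psi>"
    using False by (simp add: vec_eq_iff forall_2 circle_point_def flip: psi(3,4))
  then show ?thesis using that[of "norm c" \<psi>] psi by simp
qed

text \<open>
  The integrand of the distortion, pulled back to the angle. It is continuous, so that the
  distortion becomes an ordinary integral over \<open>[0, 2 \<pi>]\<close>.
\<close>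
definition circle_sqdist :: "(real^2) set \<Rightarrow> real \<Rightarrow> real" where
  "circle_sqdist \<alpha> \<theta> = Min ((\<lambda>c. (norm (circle_point \<theta> - c))\<^sup>2) ` \<alpha>)"

lemma continuous_on_norm_circle_point_diff:
  "continuous_on S (\<lambda>\<theta>. (norm (circle_point \<theta> - c))\<^sup>2)"
proof -
  obtain r \<psi> where "c = r *\<^sub>R circle_point \<psi>" by (rule polar_coordinates)
  then show ?thesis by (auto simp: norm_circle_point_diff intro!: continuous_intros)
qed

lemma continuous_on_circle_sqdist:
  assumes "finite \<alpha>" "\<alpha> \<noteq> {}"
  shows "continuous_on S (circle_sqdist \<alpha>)"
  unfolding circle_sqdist_def using assms
proof (induction rule: finite_ne_induct)
  case (insert c F)
  have "(\<lambda>\<theta>. Min ((\<lambda>c. (norm (circle_point \<theta> - c))\<^sup>2) ` insert c F)) =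
      (\<lambda>\<theta>. min ((norm (circle_point \<theta> - c))\<^sup>2) (Min ((\<lambda>c. (norm (circle_point \<theta> - c))\<^sup>2) ` F)))"
    using insert.hyps by auto
  then show ?case
    by (simp only:) (rule continuous_on_min[OF continuous_on_norm_circle_point_diff insert.IH])
qed (simp add: continuous_on_norm_circle_point_diff)

lemma circle_sqdist_integrable:
  assumes "finite \<alpha>" "\<alpha> \<noteq> {}"
  shows "circle_sqdist \<alpha> integrable_on {u..v}"
  using assms by (intro integrable_continuous_real continuous_on_circle_sqdist)

lemma distortion_uniform_circle:
  assumes "finite \<alpha>" "\<alpha> \<noteq> {}"
  shows "distortion uniform_circle \<alpha> = integral {0..2 * pi} (circle_sqdist \<alpha>) / (2 * pi)"
proof -
  let ?m = "\<lambda>x::real^2. Min ((\<lambda>c. (norm (x - c))\<^sup>2) ` \<alpha>)"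
  have m: "?m \<in> borel_measurable borel"
    using borel_measurable_integrable[OF integrable_distortion_uniform_circle[OF assms]]
    by (simp add: uniform_circle_def)
  \<comment> \<open>the normalised restriction of Lebesgue measure, with a real-valued density\<close>
  have um: "uniform_measure lborel {0..2 * pi} =
      density lborel (\<lambda>x. ennreal (indicator {0..2 * pi} x / (2 * pi)))"
    unfolding uniform_measure_def
    by (intro arg_cong[where f = "density lborel"] ext)
      (auto simp: indicator_def divide_ennreal[symmetric] simp flip: ennreal_1)
  have cont: "continuous_on {0..2 * pi} (circle_sqdist \<alpha>)"
    by (rule continuous_on_circle_sqdist[OF assms])
  have meas: "circle_sqdist \<alpha> \<in> borel_measurable borel"
    by (rule borel_measurable_continuous_onI) (rule continuous_on_circle_sqdist[OF assms])
  have "distortion uniform_circle \<alpha> = (\<integral>\<theta>. circle_sqdist \<alpha> \<theta> \<partial>uniform_measure lborel {0..2 * pi})"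
    unfolding distortion_def uniform_circle_def circle_sqdist_def
    using m by (subst integral_distr) (simp_all)
  also have "\<dots> = (\<integral>\<theta>. indicator {0..2 * pi} \<theta> * circle_sqdist \<alpha> \<theta> / (2 * pi) \<partial>lborel)"
    unfolding um using meas by (subst integral_density) auto
  also have "\<dots> = (LINT \<theta>:{0..2 * pi}|lborel. circle_sqdist \<alpha> \<theta>) / (2 * pi)"
    by (simp add: set_lebesgue_integral_def)
  also have "(LINT \<theta>:{0..2 * pi}|lborel. circle_sqdist \<alpha> \<theta>) = integral {0..2 * pi} (circle_sqdist \<alpha>)"
    by (intro set_borel_integral_eq_integral borel_integrable_atLeastAtMost') (rule cont)
  finally show ?thesis .
qed

section \<open>The lower bound\<close>

text \<open>
  The share of a single centre in the decoupled bound. Here \<open>1 - \<bar>x - c\<bar>\<^sup>2\<close> is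
  \<open>2 r cos (\<theta> - \<psi>) - r\<^sup>2\<close> in polar coordinates, so the integral depends on \<open>c\<close> only
  through \<open>r\<close>.
\<close>
lemma integral_cell_excess_le:
  fixes c :: "real^2"
  assumes n: "2 \<le> n" and a: "a = pi / real n"
  shows "integral {0..2 * pi} (\<lambda>\<theta>. max 0 (1 - (norm (circle_point \<theta> - c))\<^sup>2 - arc_gain_slope a))
    \<le> 2 * arc_gain_intercept a"
proof -
  obtain r \<psi> where c: "0 \<le> r" "0 \<le> \<psi>" "\<psi> \<le> 2 * pi" "c = r *\<^sub>R circle_point \<psi>"
    by (rule polar_coordinates)
  let ?B = "r\<^sup>2 + arc_gain_slope a"
  have "integral {0..2 * pi} (\<lambda>\<theta>. max 0 (1 - (norm (circle_point \<theta> - c))\<^sup>2 - arc_gain_slope a))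
      = integral {0..2 * pi} (\<lambda>\<theta>. max 0 (2 * r * cos (\<theta> - \<psi>) - ?B))"
    by (simp add: c(4) norm_circle_point_diff algebra_simps)
  also have "\<dots> = 2 * integral {0..pi} (\<lambda>\<phi>. max 0 (2 * r * cos \<phi> - ?B))"
    using c by (intro integral_cos_circle[where f = "\<lambda>x. max 0 (2 * r * x - ?B)"])
      (auto intro!: continuous_intros)
  finally have eq: "integral {0..2 * pi} (\<lambda>\<theta>. max 0 (1 - (norm (circle_point \<theta> - c))\<^sup>2 - arc_gain_slope a))
      = 2 * integral {0..pi} (\<lambda>\<phi>. max 0 (2 * r * cos \<phi> - ?B))" .
  obtain t where t: "0 \<le> t" "t \<le> pi"
    "integral {0..pi} (\<lambda>\<phi>. max 0 (2 * r * cos \<phi> - ?B)) = 2 * r * sin t - ?B * t"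
    using integral_positive_part_cos[of "2 * r" ?B] c(1) by auto
  show ?thesis unfolding eq t(3) using cell_gain_le_intercept[OF n a t(1,2), of r] by simp
qed

text \<open>
  Summing the shares of at most \<open>n\<close> centres loses nothing for the regular configuration: there
  the arcs on which \<open>f\<^sub>c\<close> exceeds the multiplier \<open>l\<close> are exactly the \<open>n\<close> equal arcs, and
  they overlap only in end points.
\<close>
lemma distortion_uniform_circle_ge:
  assumes n: "2 \<le> n" and \<alpha>: "\<alpha> \<in> codebooks n"
  shows "1 - (real n)\<^sup>2 / pi\<^sup>2 * (sin (pi / real n))\<^sup>2 \<le> distortion uniform_circle \<alpha>"
proof -
  define a where "a = pi / real n"
  have a0: "0 < a" "a \<le> pi / 2" using half_sector_bounds[OF n] by (auto simp: a_def)
  have fin: "finite \<alpha>" "\<alpha> \<noteq> {}" and card: "card \<alpha> \<le> n"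
    using \<alpha> by (auto simp: codebooks_def)
  define l K where "l = arc_gain_slope a" and "K = arc_gain_intercept a"
  define e where "e c \<theta> = max 0 (1 - (norm (circle_point \<theta> - c))\<^sup>2 - l)" for c \<theta>
  have e_int: "e c integrable_on {0..2 * pi}" for c
    unfolding e_def by (intro integrable_continuous_real continuous_intros
        continuous_on_norm_circle_point_diff)
  have pointwise: "1 - l - (\<Sum>c\<in>\<alpha>. e c \<theta>) \<le> circle_sqdist \<alpha> \<theta>" for \<theta>
  proof -
    have "circle_sqdist \<alpha> \<theta> \<in> (\<lambda>c. (norm (circle_point \<theta> - c))\<^sup>2) ` \<alpha>"
      unfolding circle_sqdist_def using fin by (intro Min_in) auto
    then obtain c where c: "c \<in> \<alpha>" "circle_sqdist \<alpha> \<theta> = (norm (circle_point \<theta> - c))\<^sup>2" by auto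
    have "e c \<theta> \<le> (\<Sum>c\<in>\<alpha>. e c \<theta>)"
      using c(1) fin by (intro member_le_sum) (auto simp: e_def)
    then show ?thesis unfolding c(2) e_def by linarith
  qed
  have K: "(\<Sum>c\<in>\<alpha>. integral {0..2 * pi} (e c)) \<le> real n * (2 * K)"
  proof -
    have "(\<Sum>c\<in>\<alpha>. integral {0..2 * pi} (e c)) \<le> real (card \<alpha>) * (2 * K)"
      unfolding e_def l_def K_def by (intro sum_bounded_above integral_cell_excess_le[OF n a_def])
    also have "\<dots> \<le> real n * (2 * K)"
      using card arc_gain_intercept_nonneg[OF a0] by (intro mult_right_mono) (auto simp: K_def)
    finally show ?thesis .
  qed
  have "2 * pi * (1 - (sin a)\<^sup>2 / a\<^sup>2) = 2 * pi * (1 - l) - real n * (2 * K)"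
  proof -
    have "(sin a)\<^sup>2 / a\<^sup>2 = l + K / a" using tangent_at_contact_point[of a] a0 by (simp add: l_def K_def)
    then show ?thesis using n by (simp add: a_def algebra_simps)
  qed
  also have "\<dots> \<le> 2 * pi * (1 - l) - (\<Sum>c\<in>\<alpha>. integral {0..2 * pi} (e c))" using K by simp
  also have "\<dots> = integral {0..2 * pi} (\<lambda>\<theta>. 1 - l - (\<Sum>c\<in>\<alpha>. e c \<theta>))"
    using fin e_int by (subst integral_diff) (auto intro!: integrable_sum simp: integral_sum)
  also have "\<dots> \<le> integral {0..2 * pi} (circle_sqdist \<alpha>)"
    using fin e_int pointwise
    by (intro integral_le integrable_diff integrable_sum circle_sqdist_integrable) auto
  finally have "1 - (sin a)\<^sup>2 / a\<^sup>2 \<le> distortion uniform_circle \<alpha>"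
    using fin by (simp add: distortion_uniform_circle field_simps)
  then show ?thesis using n by (simp add: a_def field_simps)
qed

text \<open>The circle has its centroid at the origin, so the cross term integrates to zero.\<close>
lemma distortion_uniform_circle_singleton_ge:
  "1 \<le> distortion uniform_circle {c}"
proof -
  obtain r \<psi> where c: "0 \<le> r" "0 \<le> \<psi>" "\<psi> \<le> 2 * pi" "c = r *\<^sub>R circle_point \<psi>"
    by (rule polar_coordinates)
  have "integral {0..2 * pi} (circle_sqdist {c}) =
      integral {0..2 * pi} (\<lambda>\<theta>. 1 - 2 * r * cos (\<theta> - \<psi>) + r\<^sup>2)"
    by (simp add: circle_sqdist_def[abs_def] c(4) norm_circle_point_diff)
  also have "\<dots> = (2 * pi * (1 + r\<^sup>2) - 2 * r * sin (2 * pi - \<psi>)) - (0 * (1 + r\<^sup>2) - 2 * r * sin (0 - \<psi>))"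
    by (intro integral_unique fundamental_theorem_of_calculus)
      (auto intro!: derivative_eq_intros simp: algebra_simps
        simp flip: has_real_derivative_iff_has_vector_derivative)
  also have "\<dots> = 2 * pi * (1 + r\<^sup>2)" by (simp add: sin_diff)
  finally have "distortion uniform_circle {c} = 1 + r\<^sup>2"
    by (simp add: distortion_uniform_circle)
  then show ?thesis by simp
qed

section \<open>The centroids of the regular arcs\<close>

lemma circle_means_eq:
  "circle_means n = (\<lambda>j. (real n / pi * sin (pi / real n)) *\<^sub>R
      circle_point ((2 * real j - 1) * (pi / real n))) ` {1..n}"
  unfolding circle_means_def
  by (intro image_cong refl) (simp add: vec_eq_iff forall_2 circle_point_def)

lemma circle_means_in_codebooks:
  assumes "1 \<le> n"
  shows "circle_means n \<in> codebooks n"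
proof -
  have "finite (circle_means n)" "circle_means n \<noteq> {}" "card (circle_means n) \<le> n"
    using assms card_image_le[of "{1..n}"] by (auto simp: circle_means_def)
  then show ?thesis by (auto simp: codebooks_def Suc_le_eq card_gt_0_iff)
qed

text \<open>
  On the arc from \<open>2 j a\<close> to \<open>2 (j + 1) a\<close> the distance to the nearest of the points is at
  most the distance to the centroid of that arc, so each of the \<open>n\<close> arcs contributes at most
  \<open>2 a (1 - r\<^sup>2)\<close>, where \<open>r = sin a / a\<close> is the norm of the centroids.
\<close>
lemma distortion_circle_means_le:
  assumes n: "1 \<le> n"
  shows "distortion uniform_circle (circle_means n) \<le>
    1 - (real n)\<^sup>2 / pi\<^sup>2 * (sin (pi / real n))\<^sup>2"
proof -
  define a where "a = pi / real n"
  define r where "r = sin a / a"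
  have a0: "0 < a" and na: "real n * a = pi" using n by (auto simp: a_def)
  have fin: "finite (circle_means n)" "circle_means n \<noteq> {}"
    using n by (auto simp: circle_means_def)
  let ?h = "circle_sqdist (circle_means n)"
  have arc: "integral {2 * real j * a..2 * real (Suc j) * a} ?h \<le> 2 * a * (1 - r\<^sup>2)" if "j < n" for j
  proof -
    define \<psi> where "\<psi> = (2 * real j + 1) * a"
    have mem: "r *\<^sub>R circle_point \<psi> \<in> circle_means n"
      unfolding circle_means_eq using that n
      by (intro image_eqI[of _ _ "Suc j"]) (auto simp: r_def \<psi>_def a_def algebra_simps)
    have "integral {2 * real j * a..2 * real (Suc j) * a} ?h \<le>
        integral {2 * real j * a..2 * real (Suc j) * a} (\<lambda>\<theta>. 1 - 2 * r * cos (\<theta> - \<psi>) + r\<^sup>2)"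
    proof (intro integral_le circle_sqdist_integrable fin)
      show "?h \<theta> \<le> 1 - 2 * r * cos (\<theta> - \<psi>) + r\<^sup>2" for \<theta>
        unfolding circle_sqdist_def norm_circle_point_diff[symmetric] using fin mem by simp
    qed (auto intro!: integrable_continuous_real continuous_intros)
    also have "\<dots> = (2 * real (Suc j) * a * (1 + r\<^sup>2) - 2 * r * sin (2 * real (Suc j) * a - \<psi>))
        - (2 * real j * a * (1 + r\<^sup>2) - 2 * r * sin (2 * real j * a - \<psi>))"
      using a0 by (intro integral_unique fundamental_theorem_of_calculus)
        (auto intro!: derivative_eq_intros simp: algebra_simps
          simp flip: has_real_derivative_iff_has_vector_derivative)
    also have "2 * real (Suc j) * a - \<psi> = a" by (simp add: \<psi>_def algebra_simps)
    also have "2 * real j * a - \<psi> = - a" by (simp add: \<psi>_def algebra_simps)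
    also have "(2 * real (Suc j) * a * (1 + r\<^sup>2) - 2 * r * sin a)
        - (2 * real j * a * (1 + r\<^sup>2) - 2 * r * sin (- a)) = 2 * a * (1 + r\<^sup>2) - 4 * r * sin a"
      by (simp add: algebra_simps)
    also have "\<dots> = 2 * a * (1 - r\<^sup>2)"
      using a0 by (simp add: r_def field_simps power2_eq_square)
    finally show ?thesis .
  qed
  have "integral {0..2 * real m * a} ?h \<le> real m * (2 * a * (1 - r\<^sup>2))" if "m \<le> n" for m
    using that
  proof (induction m)
    case (Suc m)
    have "integral {0..2 * real (Suc m) * a} ?h =
        integral {0..2 * real m * a} ?h + integral {2 * real m * a..2 * real (Suc m) * a} ?h"
      using a0 by (intro Henstock_Kurzweil_Integration.integral_combine[symmetric] circle_sqdist_integrable fin) auto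
    also have "\<dots> \<le> real m * (2 * a * (1 - r\<^sup>2)) + 2 * a * (1 - r\<^sup>2)"
      using Suc arc[of m] by simp
    finally show ?case by (simp add: algebra_simps)
  qed simp
  from this[of n] have "integral {0..2 * (real n * a)} ?h \<le> 2 * (real n * a) * (1 - r\<^sup>2)"
    by (simp add: mult_ac)
  then have "distortion uniform_circle (circle_means n) \<le> 1 - r\<^sup>2"
    unfolding na using fin by (simp add: distortion_uniform_circle field_simps)
  then show ?thesis using n by (simp add: r_def a_def field_simps)
qed

theorem theorem2p2p1:
  fixes n :: nat
  assumes "1 \<le> n"
  shows "optimal_n_means n uniform_circle (circle_means n) \<and>
    quantization_error n uniform_circle = 1 - (real n)\<^sup>2 / pi\<^sup>2 * (sin (pi / real n))\<^sup>2"
proof -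
  let ?V = "1 - (real n)\<^sup>2 / pi\<^sup>2 * (sin (pi / real n))\<^sup>2"
  have lower: "?V \<le> distortion uniform_circle \<alpha>" if \<alpha>: "\<alpha> \<in> codebooks n" for \<alpha>
  proof (cases "n = 1")
    case True
    then have "card \<alpha> = 1" using \<alpha> by (simp add: codebooks_def)
    then obtain c where "\<alpha> = {c}" by (auto simp: card_1_singleton_iff)
    then show ?thesis using True distortion_uniform_circle_singleton_ge[of c] by simp
  next
    case False
    then show ?thesis using assms \<alpha> by (intro distortion_uniform_circle_ge) auto
  qed
  have mem: "circle_means n \<in> codebooks n" by (rule circle_means_in_codebooks[OF assms])
  have upper: "distortion uniform_circle (circle_means n) \<le> ?V"
    by (rule distortion_circle_means_le[OF assms])
  then have eq: "distortion uniform_circle (circle_means n) = ?V" using lower[OF mem] by simp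
  have "quantization_error n uniform_circle = ?V"
    unfolding quantization_error_def
  proof (rule antisym)
    show "(INF \<alpha>\<in>codebooks n. distortion uniform_circle \<alpha>) \<le> ?V"
      using cINF_lower[OF bdd_below_distortion mem] upper by (rule order_trans)
    show "?V \<le> (INF \<alpha>\<in>codebooks n. distortion uniform_circle \<alpha>)"
      using lower mem by (intro cINF_greatest) auto
  qed
  then show ?thesis using eq mem by (simp add: optimal_n_means_def)
qed

end
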